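(* Let $z=-\frac1{\mathsf u(1+\mathsf u^2)}$ and $y=\frac{\mathsf v^2-1}{(1+\mathsf u^2)\mathsf v}$, and for $\alpha\in\widetilde W_n$ put $$V^{\mathtt B}(\mathsf u,\mathsf v)(\widehat\alpha):=\Big(-\frac{1+\mathsf u^2}{\mathsf u}\Big)^{n-1}\mathsf u^{2\varepsilon(\alpha)}\,\tau(\overline\pi(\alpha)).$$ Then $V^{\mathtt B}$ is an invariant of links inside the solid torus; that is, its value depends only on the equivalence class of $\alpha\in\bigcup_n\widetilde W_n$ under the equivalence relation generated by conjugation in each group $\widetilde W_n$ and the stabilization moves $\widetilde W_n\ni\alpha\sim\alpha\sigma_n^{\pm1}\in\widetilde W_{n+1}$.
   Context: $\mathsf u,\mathsf v$ are indeterminates and $\mathbb K=\mathbb C(\mathsf u,\mathsf v)$. Braid group of type $\mathtt B_n$: $\widetilde W_n$ is generated by $\rho_1,\sigma_1,\dots,\sigma_{n-1}$ with $\sigma_i\sigma_j=\sigma_j\sigma_i$ ($|i-j|>1$), $\sigma_i\sigma_j\sigma_i=\sigma_j\sigma_i\sigma_j$ ($|i-j|=1$), $\rho_1\sigma_i=\sigma_i\rho_1$ ($i>1$), $\rho_1\sigma_1\rho_1\sigma_1=\sigma_1\rho_1\sigma_1\rho_1$. $\varepsilon(\alpha)$ is the algebraic sum of the exponents of the $\sigma_i$'s in $\alpha$; $\widehat\alpha$ is the closure of $\alpha$ in the solid torus. By the Markov theorem for the solid torus, oriented links in the solid torus correspond to classes of $\bigcup_n\widetilde W_n$ under the equivalence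 relation in the claim. Hecke algebra of type $\mathtt B$: $\mathrm H_n(\mathsf u,\mathsf v)$ is the quotient of $\mathbb K[\widetilde W_n]$ by the relations $\sigma_i^2=1+(\mathsf u-\mathsf u^{-1})\sigma_i$, $\rho_1^2=1+(\mathsf v-\mathsf v^{-1})\rho_1$; the images of $\sigma_i,\rho_1$ are denoted $g_i,b_1$. Put $b_k:=g_{k-1}\cdots g_1b_1g_1^{-1}\cdots g_{k-1}^{-1}$. Markov trace (a known result): for any parameters $z,y$ there is a unique linear $\tau$ on $\bigcup_n\mathrm H_n(\mathsf u,\mathsf v)$ with $\tau(1)=1$; $\tau(ab)=\tau(ba)$; $\tau(ag_n)=z\tau(a)$ and $\tau(ab_{n+1})=y\tau(a)$ for $a\in\mathrm H_n(\mathsf u,\mathsf v)$. For the values of $z,y$ in the claim, $\tau$ vanishes on the two-sided ideal generated by $g_{1,2}=1+\mathsf u(g_1+g_2)+\mathsf u^2(g_1g_2+g_2g_1)+\mathsf u^3g_1g_2g_1$ and $g_{\mathtt B}=1+\mathsf ug_1+\mathsf vb_1+\mathsf u\mathsf v(g_1b_1+b_1g_1)+\mathsf u^2\mathsf v\,g_1b_1g_1+\mathsf v^2\mathsf u\,b_1g_1b_1+(\mathsf u\mathsf v)^2g_1b_1g_1b_1$, so it induces a trace $\tau$ on $\mathrm{TL}^{\mathtt B}_n(\mathsf u,\mathsf v)=\mathrm H_n(\mathsf u,\mathsf v)/\langle g_{\mathtt B},g_{1,2}\rangle$. The map $\overline\pi:\widetilde W_n\to\mathrm{TL}^{\mathtt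 B}_n(\mathsf u,\mathsf v)$ is the natural one, $\sigma_i\mapsto g_i$, $\rho_1\mapsto b_1$ (so $\tau(\overline\pi(\alpha))$ is the value of $\tau$ on the image of $\alpha$ in $\mathrm H_n(\mathsf u,\mathsf v)$). *)

theory Defs
  imports
    "HOL-Algebra.QuotRing"
    "HOL-Computational_Algebra.Polynomial"
    "HOL-Computational_Algebra.Fraction_Field"
begin

type_synonym scal = "complex poly poly fract"

text \<open>The inner polynomial variable is \<open>u\<close>, the outer one is \<open>v\<close>.\<close>

definition uu :: scal where
  "uu = Fract [:[:0, 1:]:] 1"

definition vv :: scal where
  "vv = Fract [:0, 1:] 1"

text \<open>A word is a list of letters \<open>(x, e)\<close>, standing for \<open>x\<close> if \<open>e\<close> is true and for
  \<open>x\<^sup>-\<^sup>1\<close> otherwise. A relation \<open>l = r\<close> is a pair \<open>(l, r)\<close> of words.\<close>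

type_synonym 'g word = "('g \<times> bool) list"

definition words :: "'g set \<Rightarrow> 'g word set" where
  "words S = lists (S \<times> UNIV)"

inductive_set pres_rel :: "'g set \<Rightarrow> 'g word rel \<Rightarrow> 'g word rel"
  for S :: "'g set" and R :: "'g word rel" where
  refl: "w \<in> words S \<Longrightarrow> (w, w) \<in> pres_rel S R"
| sym: "(w, w') \<in> pres_rel S R \<Longrightarrow> (w', w) \<in> pres_rel S R"
| trans: "(w, w') \<in> pres_rel S R \<Longrightarrow> (w', w'') \<in> pres_rel S R \<Longrightarrow> (w, w'') \<in> pres_rel S R"
| cancel: "x \<in> S \<Longrightarrow> p \<in> words S \<Longrightarrow> q \<in> words S \<Longrightarrow>
    (p @ [(x, e), (x, \<not> e)] @ q, p @ q) \<in> pres_rel S R"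
| relator: "(l, r) \<in> R \<Longrightarrow> l \<in> words S \<Longrightarrow> r \<in> words S \<Longrightarrow> p \<in> words S \<Longrightarrow> q \<in> words S \<Longrightarrow>
    (p @ l @ q, p @ r @ q) \<in> pres_rel S R"

definition presented_group :: "'g set \<Rightarrow> 'g word rel \<Rightarrow> 'g word set monoid" where
  "presented_group S R =
    \<lparr> carrier = words S // pres_rel S R,
      monoid.mult = (\<lambda>A B. \<Union>a\<in>A. \<Union>b\<in>B. pres_rel S R `` {a @ b}),
      monoid.one = pres_rel S R `` {[]} \<rparr>"

datatype braid_gen = Rho | Sigma nat

type_synonym braid = "braid_gen word set"

definition braid_gens :: "nat \<Rightarrow> braid_gen set" where
  "braid_gens n = insert Rho (Sigma ` {1..<n})"

abbreviation R1 :: "braid_gen \<times> bool" where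
  "R1 \<equiv> (Rho, True)"

abbreviation Sg :: "nat \<Rightarrow> braid_gen \<times> bool" where
  "Sg i \<equiv> (Sigma i, True)"

definition braid_relations :: "nat \<Rightarrow> braid_gen word rel" where
  "braid_relations n =
     {([Sg i, Sg j], [Sg j, Sg i]) | i j. i \<in> {1..<n} \<and> j \<in> {1..<n} \<and> \<bar>int i - int j\<bar> > 1}
   \<union> {([Sg i, Sg j, Sg i], [Sg j, Sg i, Sg j]) | i j.
        i \<in> {1..<n} \<and> j \<in> {1..<n} \<and> \<bar>int i - int j\<bar> = 1}
   \<union> {([R1, Sg i], [Sg i, R1]) | i. i \<in> {1..<n} \<and> i > 1}
   \<union> (if n \<ge> 2 then {([R1, Sg 1, R1, Sg 1], [Sg 1, R1, Sg 1, R1])} else {})"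

abbreviation braid_rel :: "nat \<Rightarrow> braid_gen word rel" where
  "braid_rel n \<equiv> pres_rel (braid_gens n) (braid_relations n)"

definition braid_group :: "nat \<Rightarrow> braid monoid" where
  "braid_group n = presented_group (braid_gens n) (braid_relations n)"

definition \<rho>\<^sub>1 :: "nat \<Rightarrow> braid" where
  "\<rho>\<^sub>1 n = braid_rel n `` {[(Rho, True)]}"

definition \<sigma> :: "nat \<Rightarrow> nat \<Rightarrow> braid" where
  "\<sigma> n i = braid_rel n `` {[(Sigma i, True)]}"

text \<open>The natural map from the \<open>n\<close>-th braid group to the next one: the class of a word is sent to
  the class of the same word.\<close>

definition braid_incl :: "nat \<Rightarrow> braid \<Rightarrow> braid" where
  "braid_incl n \<alpha> = braid_rel (Suc n) `` \<alpha>"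

fun letter_exp :: "braid_gen \<times> bool \<Rightarrow> int" where
  "letter_exp (Rho, e) = 0"
| "letter_exp (Sigma i, e) = (if e then 1 else - 1)"

text \<open>All braid relations preserve the exponent sum, so any representing word may be used.\<close>

definition exp_sum :: "braid \<Rightarrow> int" where
  "exp_sum \<alpha> = sum_list (map letter_exp (SOME w. w \<in> \<alpha>))"

definition ga_single :: "'g \<Rightarrow> 'k::field \<Rightarrow> 'g \<Rightarrow> 'k" where
  "ga_single x c = (\<lambda>y. if y = x then c else 0)"

definition ga_supp :: "('g \<Rightarrow> 'k::field) \<Rightarrow> 'g set" where
  "ga_supp f = {x. f x \<noteq> 0}"

definition group_algebra :: "('g, 'm) monoid_scheme \<Rightarrow> ('g \<Rightarrow> 'k::field) ring" where
  "group_algebra G =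
    \<lparr> carrier = {f. finite (ga_supp f) \<and> ga_supp f \<subseteq> carrier G},
      monoid.mult = (\<lambda>f h x. \<Sum>(y, z) \<in> {(y, z). y \<in> ga_supp f \<and> z \<in> ga_supp h \<and> y \<otimes>\<^bsub>G\<^esub> z = x}. f y * h z),
      monoid.one = ga_single \<one>\<^bsub>G\<^esub> 1,
      ring.zero = (\<lambda>x. 0),
      ring.add = (\<lambda>f h x. f x + h x) \<rparr>"

definition ga_map :: "('g \<Rightarrow> 'h) \<Rightarrow> ('g \<Rightarrow> 'k::field) \<Rightarrow> 'h \<Rightarrow> 'k" where
  "ga_map \<phi> f = (\<lambda>y. \<Sum>x \<in> {x \<in> ga_supp f. \<phi> x = y}. f x)"

abbreviation KW :: "nat \<Rightarrow> (braid \<Rightarrow> scal) ring" where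
  "KW n \<equiv> group_algebra (braid_group n)"

definition KW_scal :: "nat \<Rightarrow> scal \<Rightarrow> braid \<Rightarrow> scal" where
  "KW_scal n c = ga_single \<one>\<^bsub>braid_group n\<^esub> c"

definition quadratic :: "nat \<Rightarrow> scal \<Rightarrow> braid \<Rightarrow> (braid \<Rightarrow> scal)" where
  "quadratic n q x = (let X = ga_single x 1 in
     (X \<otimes>\<^bsub>KW n\<^esub> X) \<ominus>\<^bsub>KW n\<^esub> (\<one>\<^bsub>KW n\<^esub> \<oplus>\<^bsub>KW n\<^esub> KW_scal n (q - inverse q) \<otimes>\<^bsub>KW n\<^esub> X))"

definition hecke_ideal :: "nat \<Rightarrow> (braid \<Rightarrow> scal) set" where
  "hecke_ideal n = Idl\<^bsub>KW n\<^esub>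
     ({quadratic n uu (\<sigma> n i) | i. i \<in> {1..<n}} \<union> {quadratic n vv (\<rho>\<^sub>1 n)})"

type_synonym hecke_elt = "(braid \<Rightarrow> scal) set"

definition Hecke :: "nat \<Rightarrow> hecke_elt ring" where
  "Hecke n = KW n Quot hecke_ideal n"

definition hecke_proj :: "nat \<Rightarrow> (braid \<Rightarrow> scal) \<Rightarrow> hecke_elt" where
  "hecke_proj n f = hecke_ideal n +>\<^bsub>KW n\<^esub> f"

definition hecke_scal :: "nat \<Rightarrow> scal \<Rightarrow> hecke_elt" where
  "hecke_scal n c = hecke_proj n (KW_scal n c)"

definition hecke_of :: "nat \<Rightarrow> braid \<Rightarrow> hecke_elt" where
  "hecke_of n \<alpha> = hecke_proj n (ga_single \<alpha> 1)"

abbreviation hecke_g :: "nat \<Rightarrow> nat \<Rightarrow> hecke_elt" where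
  "hecke_g n i \<equiv> hecke_of n (\<sigma> n i)"

text \<open>\<open>hecke_b n k\<close> is the element \<open>b\<^sub>k\<close> of the \<open>n\<close>-th Hecke algebra, for \<open>1 \<le> k \<le> n\<close>;
  the value at \<open>0\<close> is irrelevant.\<close>

fun hecke_b :: "nat \<Rightarrow> nat \<Rightarrow> hecke_elt" where
  "hecke_b n 0 = \<one>\<^bsub>Hecke n\<^esub>"
| "hecke_b n (Suc 0) = hecke_of n (\<rho>\<^sub>1 n)"
| "hecke_b n (Suc (Suc k)) =
     hecke_g n (Suc k) \<otimes>\<^bsub>Hecke n\<^esub> hecke_b n (Suc k) \<otimes>\<^bsub>Hecke n\<^esub> inv\<^bsub>Hecke n\<^esub> hecke_g n (Suc k)"

text \<open>The natural map from the \<open>n\<close>-th Hecke algebra to the next one. The union is over sets that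
  all coincide, since the induced map of group algebras sends the defining ideal into the next one.\<close>

definition hecke_incl :: "nat \<Rightarrow> hecke_elt \<Rightarrow> hecke_elt" where
  "hecke_incl n x = (\<Union>f\<in>x. hecke_proj (Suc n) (ga_map (braid_incl n) f))"

text \<open>A linear functional on the union of the Hecke algebras is a family of linear functionals
  compatible with the inclusions.\<close>

definition markov_trace :: "scal \<Rightarrow> scal \<Rightarrow> (nat \<Rightarrow> hecke_elt \<Rightarrow> scal) \<Rightarrow> bool" where
  "markov_trace z y \<tau> \<longleftrightarrow> (\<forall>n\<ge>1.
     (\<forall>a\<in>carrier (Hecke n). \<forall>b\<in>carrier (Hecke n). \<tau> n (a \<oplus>\<^bsub>Hecke n\<^esub> b) = \<tau> n a + \<tau> n b) \<and>
     (\<forall>c. \<forall>a\<in>carrier (Hecke n). \<tau> n (hecke_scal n c \<otimes>\<^bsub>Hecke n\<^esub> a) = c * \<tau> n a) \<and>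
     (\<forall>a\<in>carrier (Hecke n). \<tau> (Suc n) (hecke_incl n a) = \<tau> n a) \<and>
     \<tau> n \<one>\<^bsub>Hecke n\<^esub> = 1 \<and>
     (\<forall>a\<in>carrier (Hecke n). \<forall>b\<in>carrier (Hecke n).
        \<tau> n (a \<otimes>\<^bsub>Hecke n\<^esub> b) = \<tau> n (b \<otimes>\<^bsub>Hecke n\<^esub> a)) \<and>
     (\<forall>a\<in>carrier (Hecke n).
        \<tau> (Suc n) (hecke_incl n a \<otimes>\<^bsub>Hecke (Suc n)\<^esub> hecke_g (Suc n) n) = z * \<tau> n a) \<and>
     (\<forall>a\<in>carrier (Hecke n).
        \<tau> (Suc n) (hecke_incl n a \<otimes>\<^bsub>Hecke (Suc n)\<^esub> hecke_b (Suc n) (Suc n)) = y * \<tau> n a))"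

context
  fixes H :: "('a, 'm) ring_scheme" (structure)
    and s :: "scal \<Rightarrow> 'a"
begin

definition g12_in :: "'a \<Rightarrow> 'a \<Rightarrow> 'a" where
  "g12_in g1 g2 =
     \<one> \<oplus> s uu \<otimes> (g1 \<oplus> g2) \<oplus> s (uu ^ 2) \<otimes> (g1 \<otimes> g2 \<oplus> g2 \<otimes> g1)
     \<oplus> s (uu ^ 3) \<otimes> (g1 \<otimes> g2 \<otimes> g1)"

definition gB_in :: "'a \<Rightarrow> 'a \<Rightarrow> 'a" where
  "gB_in g1 b1 =
     \<one> \<oplus> s uu \<otimes> g1 \<oplus> s vv \<otimes> b1 \<oplus> s (uu * vv) \<otimes> (g1 \<otimes> b1 \<oplus> b1 \<otimes> g1)
     \<oplus> s (uu ^ 2 * vv) \<otimes> (g1 \<otimes> b1 \<otimes> g1) \<oplus> s (vv ^ 2 * uu) \<otimes> (b1 \<otimes> g1 \<otimes> b1)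
     \<oplus> s ((uu * vv) ^ 2) \<otimes> (g1 \<otimes> b1 \<otimes> g1 \<otimes> b1)"

end

text \<open>The generator involving \<open>g\<^sub>1\<close> exists only for \<open>n \<ge> 2\<close>, the one involving \<open>g\<^sub>2\<close> only for \<open>n \<ge> 3\<close>.\<close>

definition TL_ideal :: "nat \<Rightarrow> hecke_elt set" where
  "TL_ideal n = Idl\<^bsub>Hecke n\<^esub>
     ((if n \<ge> 2 then {gB_in (Hecke n) (hecke_scal n) (hecke_g n 1) (hecke_b n 1)} else {})
    \<union> (if n \<ge> 3 then {g12_in (Hecke n) (hecke_scal n) (hecke_g n 1) (hecke_g n 2)} else {}))"

type_synonym TL_elt = "hecke_elt set"

definition TL :: "nat \<Rightarrow> TL_elt ring" where
  "TL n = Hecke n Quot TL_ideal n"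

definition TL_proj :: "nat \<Rightarrow> hecke_elt \<Rightarrow> TL_elt" where
  "TL_proj n x = TL_ideal n +>\<^bsub>Hecke n\<^esub> x"

definition pibar :: "nat \<Rightarrow> braid \<Rightarrow> TL_elt" where
  "pibar n \<alpha> = TL_proj n (hecke_of n \<alpha>)"

definition induced_on_TL ::
    "(nat \<Rightarrow> hecke_elt \<Rightarrow> scal) \<Rightarrow> (nat \<Rightarrow> TL_elt \<Rightarrow> scal) \<Rightarrow> bool" where
  "induced_on_TL \<tau> \<tau>' \<longleftrightarrow> (\<forall>n\<ge>1. \<forall>x\<in>carrier (Hecke n). \<tau>' n (TL_proj n x) = \<tau> n x)"

definition VB :: "(nat \<Rightarrow> TL_elt \<Rightarrow> scal) \<Rightarrow> nat \<Rightarrow> braid \<Rightarrow> scal" where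
  "VB \<tau>' n \<alpha> =
     (- ((1 + uu ^ 2) / uu)) ^ (n - 1) * uu powi (2 * exp_sum \<alpha>) * \<tau>' n (pibar n \<alpha>)"

text \<open>Elements of the union of the braid groups are pairs \<open>(n, \<alpha>)\<close>, with \<open>n \<ge> 1\<close> the number of
  strands.\<close>

inductive markov_move :: "nat \<times> braid \<Rightarrow> nat \<times> braid \<Rightarrow> bool" where
  conjugation: "n \<ge> 1 \<Longrightarrow> \<alpha> \<in> carrier (braid_group n) \<Longrightarrow> \<beta> \<in> carrier (braid_group n) \<Longrightarrow>
    markov_move (n, \<alpha>) (n, \<beta> \<otimes>\<^bsub>braid_group n\<^esub> \<alpha> \<otimes>\<^bsub>braid_group n\<^esub> inv\<^bsub>braid_group n\<^esub> \<beta>)"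
| stab_pos: "n \<ge> 1 \<Longrightarrow> \<alpha> \<in> carrier (braid_group n) \<Longrightarrow>
    markov_move (n, \<alpha>) (Suc n, braid_incl n \<alpha> \<otimes>\<^bsub>braid_group (Suc n)\<^esub> \<sigma> (Suc n) n)"
| stab_neg: "n \<ge> 1 \<Longrightarrow> \<alpha> \<in> carrier (braid_group n) \<Longrightarrow>
    markov_move (n, \<alpha>)
      (Suc n, braid_incl n \<alpha> \<otimes>\<^bsub>braid_group (Suc n)\<^esub> inv\<^bsub>braid_group (Suc n)\<^esub> \<sigma> (Suc n) n)"

end

(* Since \<tau>' composed with the projection to the Temperley-Lieb quotient is the Markov trace \<tau>, each
   Markov move is tested on \<tau> itself. Conjugation is the trace property. The quadratic relation gives
   g_n\<^sup>-\<^sup>1 = g_n - (u - u\<^sup>-\<^sup>1), so the positive and negative stabilizations scale the trace by z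
   and by z - u + u\<^sup>-\<^sup>1 = - u^3/(1 + u^2); the two remaining factors of the invariant change by
   - (1 + u^2)/u and by u^2 or u^(-2), which cancels both scalings. The real work is to see that a
   braid and its image on one more strand have matching classes in the Hecke algebras, i.e. that the
   map of group algebras carries the defining ideal into the next one. *)
theory Submission
  imports Defs
begin

section \<open>Presented groups\<close>

lemma words_append [simp]: "a @ b \<in> words S \<longleftrightarrow> a \<in> words S \<and> b \<in> words S"
  by (auto simp: words_def)

lemma words_Nil [simp]: "[] \<in> words S"
  by (auto simp: words_def)

lemma words_Cons [simp]: "(x, e) # w \<in> words S \<longleftrightarrow> x \<in> S \<and> w \<in> words S"
  by (auto simp: words_def)

lemma words_mono: "S \<subseteq> S' \<Longrightarrow> words S \<subseteq> words S'"
  unfolding words_def by (intro lists_mono) auto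

lemma pres_rel_words:
  assumes "(w, w') \<in> pres_rel S R"
  shows "w \<in> words S \<and> w' \<in> words S"
  using assms by induction auto

lemma equiv_pres_rel: "equiv (words S) (pres_rel S R)"
proof (rule equivI)
  show "pres_rel S R \<subseteq> words S \<times> words S"
    by (auto dest: pres_rel_words)
  show "refl_on (words S) (pres_rel S R)"
    by (auto simp: refl_on_def intro: pres_rel.refl)
  show "sym (pres_rel S R)"
    by (auto intro: symI pres_rel.sym)
  show "trans (pres_rel S R)"
    by (auto intro: transI pres_rel.trans)
qed

text \<open>The rules \<open>cancel\<close> and \<open>relator\<close> already carry arbitrary
  surrounding words \<open>p\<close> and \<open>q\<close>, so a further context \<open>a\<close>,
  \<open>b\<close> is absorbed into them; the other rules commute with adding a context.\<close>

lemma pres_rel_context: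
  assumes "(w, w') \<in> pres_rel S R" "a \<in> words S" "b \<in> words S"
  shows "(a @ w @ b, a @ w' @ b) \<in> pres_rel S R"
  using assms
proof induction
  case (cancel x p q e)
  show ?case
    using pres_rel.cancel[of x S "a @ p" "q @ b" e] cancel by simp
next
  case (relator l r p q)
  show ?case
    using pres_rel.relator[of l r R S "a @ p" "q @ b"] relator by simp
qed (auto intro: pres_rel.intros)

text \<open>One factor is changed at a time, through the intermediate word
  \<open>v' @ w\<close>.\<close>

lemma pres_rel_append:
  assumes "(v, v') \<in> pres_rel S R" "(w, w') \<in> pres_rel S R"
  shows "(v @ w, v' @ w') \<in> pres_rel S R"
  using pres_rel_context[OF assms(1), of "[]" w] pres_rel_context[OF assms(2), of v' "[]"]
    pres_rel_words[OF assms(1)] pres_rel_words[OF assms(2)]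
  by (auto intro: pres_rel.trans)

text \<open>A derivation over the smaller presentation is also one over the larger. This is what
  later makes adding a strand well defined on braids.\<close>

lemma pres_rel_mono:
  assumes "S \<subseteq> S'" "R \<subseteq> R'"
  shows "pres_rel S R \<subseteq> pres_rel S' R'"
proof (rule subrelI)
  fix w w' assume "(w, w') \<in> pres_rel S R"
  then show "(w, w') \<in> pres_rel S' R'"
    by induction (use assms words_mono[OF assms(1)] in \<open>blast intro: pres_rel.intros\<close>)+
qed

section \<open>The group of classes of words\<close>

lemma carrier_presented_group: "carrier (presented_group S R) = words S // pres_rel S R"
  by (simp add: presented_group_def)

lemma one_presented_group: "\<one>\<^bsub>presented_group S R\<^esub> = pres_rel S R `` {[]}"
  by (simp add: presented_group_def)

lemma class_in_presented_group:
  "w \<in> words S \<Longrightarrow> pres_rel S R `` {w} \<in> carrier (presented_group S R)"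
  by (simp add: carrier_presented_group quotientI)

lemma presented_group_class:
  assumes "\<alpha> \<in> carrier (presented_group S R)"
  obtains w where "w \<in> words S" "\<alpha> = pres_rel S R `` {w}"
  using assms by (auto simp: carrier_presented_group elim: quotientE)

text \<open>The product is defined as a union over all pairs of representatives. Since concatenation
  respects the relation, all sets in that union are the same class, and from here on products are
  computed on single words.\<close>

lemma mult_presented_group:
  assumes "v \<in> words S" "w \<in> words S"
  shows "(pres_rel S R `` {v}) \<otimes>\<^bsub>presented_group S R\<^esub> (pres_rel S R `` {w}) = pres_rel S R `` {v @ w}"
proof -
  have "congruent2 (pres_rel S R) (pres_rel S R) (\<lambda>a b. pres_rel S R `` {a @ b})"
    by (auto simp: congruent2_def intro!: equiv_class_eq[OF equiv_pres_rel] pres_rel_append)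
  from UN_equiv_class2[OF equiv_pres_rel equiv_pres_rel this assms] show ?thesis
    by (simp add: presented_group_def)
qed

definition word_inv :: "'g word \<Rightarrow> 'g word" where
  "word_inv w = rev (map (\<lambda>(x, e). (x, \<not> e)) w)"

lemma word_inv_words [simp]: "word_inv w \<in> words S \<longleftrightarrow> w \<in> words S"
  by (force simp: word_inv_def words_def)

lemma word_inv_left: "w \<in> words S \<Longrightarrow> (word_inv w @ w, []) \<in> pres_rel S R"
proof (induction w)
  case Nil
  then show ?case by (auto simp: word_inv_def intro: pres_rel.refl)
next
  case (Cons a w)
  obtain x e where a: "a = (x, e)" by force
  \<comment> \<open>The inverse of \<open>a # w\<close> ends in the flipped letter of
    \<open>a\<close>, which cancels against \<open>a\<close> in the middle. The double negation
    gives the pair of letters the shape of the rule \<open>cancel\<close>.\<close>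
  have "(word_inv w @ [(x, \<not> e), (x, \<not> \<not> e)] @ w, word_inv w @ w) \<in> pres_rel S R"
    using Cons.prems by (intro pres_rel.cancel) (auto simp: a)
  then have "(word_inv (a # w) @ a # w, word_inv w @ w) \<in> pres_rel S R"
    by (simp add: word_inv_def a)
  then show ?case
    using Cons by (auto simp: a intro: pres_rel.trans)
qed

lemma group_presented_group: "group (presented_group S R)"
proof (rule groupI)
  fix \<alpha> \<beta> assume "\<alpha> \<in> carrier (presented_group S R)" "\<beta> \<in> carrier (presented_group S R)"
  then show "\<alpha> \<otimes>\<^bsub>presented_group S R\<^esub> \<beta> \<in> carrier (presented_group S R)"
    by (metis presented_group_class mult_presented_group class_in_presented_group words_append)
next
  show "\<one>\<^bsub>presented_group S R\<^esub> \<in> carrier (presented_group S R)"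
    by (simp add: one_presented_group class_in_presented_group)
next
  fix \<alpha> \<beta> \<gamma>
  assume "\<alpha> \<in> carrier (presented_group S R)" "\<beta> \<in> carrier (presented_group S R)"
    "\<gamma> \<in> carrier (presented_group S R)"
  then show "\<alpha> \<otimes>\<^bsub>presented_group S R\<^esub> \<beta> \<otimes>\<^bsub>presented_group S R\<^esub> \<gamma> =
      \<alpha> \<otimes>\<^bsub>presented_group S R\<^esub> (\<beta> \<otimes>\<^bsub>presented_group S R\<^esub> \<gamma>)"
    by (elim presented_group_class) (simp add: mult_presented_group)
next
  fix \<alpha> assume \<alpha>: "\<alpha> \<in> carrier (presented_group S R)"
  then show "\<one>\<^bsub>presented_group S R\<^esub> \<otimes>\<^bsub>presented_group S R\<^esub> \<alpha> = \<alpha>"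
    by (elim presented_group_class) (simp add: mult_presented_group one_presented_group)
  from \<alpha> obtain w where w: "w \<in> words S" "\<alpha> = pres_rel S R `` {w}"
    by (rule presented_group_class)
  then have "pres_rel S R `` {word_inv w} \<otimes>\<^bsub>presented_group S R\<^esub> \<alpha> = \<one>\<^bsub>presented_group S R\<^esub>"
    by (simp add: mult_presented_group one_presented_group
        equiv_class_eq[OF equiv_pres_rel word_inv_left])
  with w show "\<exists>\<beta>\<in>carrier (presented_group S R). \<beta> \<otimes>\<^bsub>presented_group S R\<^esub> \<alpha> = \<one>\<^bsub>presented_group S R\<^esub>"
    using class_in_presented_group[of "word_inv w" S R] by auto
qed

section \<open>Group algebras\<close>

text \<open>A finitely supported function is determined by its pairings with arbitrary functions. The
  convolution product satisfies \<open>\<langle>f * h, \<phi>\<rangle> = \<langle>f, \<lambda>a. \<langle>h, \<lambda>b. \<phi> (a b)\<rangle>\<rangle>\<close>, so the ring laws reduce to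
  the monoid laws without any reindexing of sums.\<close>

definition ga_pair :: "('g \<Rightarrow> 'k::field) \<Rightarrow> ('g \<Rightarrow> 'k) \<Rightarrow> 'k" where
  "ga_pair f \<phi> = (\<Sum>x\<in>ga_supp f. f x * \<phi> x)"

text \<open>Cancellation can make the support of a sum, product or image smaller than expected. This
  allows summing over a convenient common finite set instead.\<close>

lemma ga_pair_superset:
  assumes "finite A" "ga_supp f \<subseteq> A"
  shows "ga_pair f \<phi> = (\<Sum>x\<in>A. f x * \<phi> x)"
  unfolding ga_pair_def using assms by (intro sum.mono_neutral_left) (auto simp: ga_supp_def)

lemma ga_pair_delta:
  assumes "finite (ga_supp f)"
  shows "ga_pair f (\<lambda>y. if y = x then 1 else 0) = f x"
  using assms by (auto simp: ga_pair_def ga_supp_def if_distrib cong: if_cong)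

text \<open>Pairing with the indicator of a point returns the coefficient there. Finiteness matters
  because \<open>sum\<close> over an infinite set is 0 by convention.\<close>

lemma ga_eqI:
  assumes "finite (ga_supp f)" "finite (ga_supp h)" "\<And>\<phi>. ga_pair f \<phi> = ga_pair h \<phi>"
  shows "f = h"
  using assms by (metis ext ga_pair_delta)

lemma ga_pair_add_right: "ga_pair f (\<lambda>x. \<phi> x + \<psi> x) = ga_pair f \<phi> + ga_pair f \<psi>"
  by (simp add: ga_pair_def algebra_simps sum.distrib)

lemma ga_pair_cong:
  assumes "\<And>x. x \<in> ga_supp f \<Longrightarrow> \<phi> x = \<psi> x"
  shows "ga_pair f \<phi> = ga_pair f \<psi>"
  using assms by (simp add: ga_pair_def)

lemma ga_supp_add: "ga_supp (\<lambda>x. f x + h x) \<subseteq> ga_supp f \<union> ga_supp h"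
  by (auto simp: ga_supp_def)

lemma ga_pair_add_left:
  assumes "finite (ga_supp f)" "finite (ga_supp h)"
  shows "ga_pair (\<lambda>x. f x + h x) \<phi> = ga_pair f \<phi> + ga_pair h \<phi>"
proof -
  let ?A = "ga_supp f \<union> ga_supp h"
  have "ga_pair (\<lambda>x. f x + h x) \<phi> = (\<Sum>x\<in>?A. (f x + h x) * \<phi> x)"
    using assms ga_supp_add[of f h] by (intro ga_pair_superset) simp_all
  moreover have "ga_pair f \<phi> = (\<Sum>x\<in>?A. f x * \<phi> x)" "ga_pair h \<phi> = (\<Sum>x\<in>?A. h x * \<phi> x)"
    using assms by (auto intro: ga_pair_superset)
  ultimately show ?thesis
    by (simp add: algebra_simps sum.distrib)
qed

lemma ga_supp_single: "ga_supp (ga_single x c) \<subseteq> {x}"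
  by (auto simp: ga_supp_def ga_single_def)

lemma finite_ga_supp_single [simp]: "finite (ga_supp (ga_single x c))"
  by (rule finite_subset[OF ga_supp_single]) simp

lemma ga_pair_single [simp]: "ga_pair (ga_single x c) \<phi> = c * \<phi> x"
  by (subst ga_pair_superset[OF _ ga_supp_single]) (auto simp: ga_single_def)

lemma group_algebra_carrier:
  "f \<in> carrier (group_algebra G) \<longleftrightarrow> finite (ga_supp f) \<and> ga_supp f \<subseteq> carrier G"
  by (simp add: group_algebra_def)

lemma ga_single_carrier [simp]: "x \<in> carrier G \<Longrightarrow> ga_single x c \<in> carrier (group_algebra G)"
  using ga_supp_single[of x c] by (auto simp: group_algebra_carrier)

lemma group_algebra_one: "\<one>\<^bsub>group_algebra G\<^esub> = ga_single \<one>\<^bsub>G\<^esub> 1"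
  by (simp add: group_algebra_def)

lemma group_algebra_zero: "\<zero>\<^bsub>group_algebra G\<^esub> = (\<lambda>x. 0)"
  by (simp add: group_algebra_def)

lemma group_algebra_add: "f \<oplus>\<^bsub>group_algebra G\<^esub> h = (\<lambda>x. f x + h x)"
  by (simp add: group_algebra_def)

text \<open>The condition on the product moves from the summation range into the summand, so that
  the range no longer depends on \<open>x\<close> and sums can be exchanged.\<close>

lemma group_algebra_mult_eq:
  assumes "finite (ga_supp f)" "finite (ga_supp h)"
  shows "(f \<otimes>\<^bsub>group_algebra G\<^esub> h) x =
    (\<Sum>p\<in>ga_supp f \<times> ga_supp h. if fst p \<otimes>\<^bsub>G\<^esub> snd p = x then f (fst p) * h (snd p) else 0)"
proof -
  have "{(y, z). y \<in> ga_supp f \<and> z \<in> ga_supp h \<and> y \<otimes>\<^bsub>G\<^esub> z = x} =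
      {p \<in> ga_supp f \<times> ga_supp h. fst p \<otimes>\<^bsub>G\<^esub> snd p = x}"
    by auto
  then show ?thesis
    using assms by (simp add: group_algebra_def case_prod_beta sum.inter_filter)
qed

lemma group_algebra_mult_supp:
  assumes "finite (ga_supp f)" "finite (ga_supp h)"
  shows "ga_supp (f \<otimes>\<^bsub>group_algebra G\<^esub> h) \<subseteq> (\<lambda>p. fst p \<otimes>\<^bsub>G\<^esub> snd p) ` (ga_supp f \<times> ga_supp h)"
proof
  fix x assume "x \<in> ga_supp (f \<otimes>\<^bsub>group_algebra G\<^esub> h)"
  then have "(f \<otimes>\<^bsub>group_algebra G\<^esub> h) x \<noteq> 0"
    by (simp add: ga_supp_def)
  then obtain p where "p \<in> ga_supp f \<times> ga_supp h" "fst p \<otimes>\<^bsub>G\<^esub> snd p = x"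
    unfolding group_algebra_mult_eq[OF assms]
    by (rule sum.not_neutral_contains_not_neutral) (auto split: if_splits)
  then show "x \<in> (\<lambda>p. fst p \<otimes>\<^bsub>G\<^esub> snd p) ` (ga_supp f \<times> ga_supp h)"
    by blast
qed

lemma ga_pair_mult:
  assumes "finite (ga_supp f)" "finite (ga_supp h)"
  shows "ga_pair (f \<otimes>\<^bsub>group_algebra G\<^esub> h) \<phi> = ga_pair f (\<lambda>a. ga_pair h (\<lambda>b. \<phi> (a \<otimes>\<^bsub>G\<^esub> b)))"
proof -
  let ?P = "ga_supp f \<times> ga_supp h"
  let ?C = "(\<lambda>p. fst p \<otimes>\<^bsub>G\<^esub> snd p) ` ?P"
  have fin: "finite ?P" "finite ?C"
    using assms by auto
  have "ga_pair (f \<otimes>\<^bsub>group_algebra G\<^esub> h) \<phi> = (\<Sum>x\<in>?C. (f \<otimes>\<^bsub>group_algebra G\<^esub> h) x * \<phi> x)"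
    using fin group_algebra_mult_supp[OF assms] by (intro ga_pair_superset)
  also have "\<dots> = (\<Sum>x\<in>?C. \<Sum>p\<in>?P. if fst p \<otimes>\<^bsub>G\<^esub> snd p = x then f (fst p) * h (snd p) * \<phi> x else 0)"
    unfolding group_algebra_mult_eq[OF assms] sum_distrib_right
    by (intro sum.cong HOL.refl) auto
  also have "\<dots> = (\<Sum>p\<in>?P. \<Sum>x\<in>?C. if fst p \<otimes>\<^bsub>G\<^esub> snd p = x then f (fst p) * h (snd p) * \<phi> x else 0)"
    by (rule sum.swap)
  \<comment> \<open>For a fixed pair, exactly one \<open>x\<close> contributes, namely the product
    of the pair, and it lies in \<open>?C\<close>.\<close>
  also have "\<dots> = (\<Sum>p\<in>?P. f (fst p) * h (snd p) * \<phi> (fst p \<otimes>\<^bsub>G\<^esub> snd p))"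
    using fin(2) by (intro sum.cong[OF HOL.refl]) (subst sum.delta', auto)
  also have "\<dots> = (\<Sum>a\<in>ga_supp f. \<Sum>b\<in>ga_supp h. f a * h b * \<phi> (a \<otimes>\<^bsub>G\<^esub> b))"
    by (simp add: sum.cartesian_product case_prod_beta)
  also have "\<dots> = ga_pair f (\<lambda>a. ga_pair h (\<lambda>b. \<phi> (a \<otimes>\<^bsub>G\<^esub> b)))"
    by (simp add: ga_pair_def sum_distrib_left mult.assoc)
  finally show ?thesis .
qed

lemma group_algebra_mult_finite:
  assumes "finite (ga_supp f)" "finite (ga_supp h)"
  shows "finite (ga_supp (f \<otimes>\<^bsub>group_algebra G\<^esub> h))"
  using assms by (intro finite_subset[OF group_algebra_mult_supp]) auto

lemma group_algebra_add_finite: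
  assumes "finite (ga_supp f)" "finite (ga_supp h)"
  shows "finite (ga_supp (f \<oplus>\<^bsub>group_algebra G\<^esub> h))"
  unfolding group_algebra_add using assms by (intro finite_subset[OF ga_supp_add]) auto

lemma ga_pair_add:
  assumes "finite (ga_supp f)" "finite (ga_supp h)"
  shows "ga_pair (f \<oplus>\<^bsub>group_algebra G\<^esub> h) \<phi> = ga_pair f \<phi> + ga_pair h \<phi>"
  unfolding group_algebra_add by (rule ga_pair_add_left[OF assms])

lemmas ga_finite = group_algebra_mult_finite group_algebra_add_finite

lemma abelian_group_group_algebra:
  "abelian_group (group_algebra G :: ('a \<Rightarrow> 'k::field) ring)"
proof (rule abelian_groupI)
  fix f :: "'a \<Rightarrow> 'k" assume f: "f \<in> carrier (group_algebra G)"
  have "ga_supp (\<lambda>x. - f x) = ga_supp f"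
    by (simp add: ga_supp_def)
  with f show "\<exists>h\<in>carrier (group_algebra G). h \<oplus>\<^bsub>group_algebra G\<^esub> f = \<zero>\<^bsub>group_algebra G\<^esub>"
    by (intro bexI[of _ "\<lambda>x. - f x"])
      (auto simp: group_algebra_carrier group_algebra_add group_algebra_zero)
next
  fix f h :: "'a \<Rightarrow> 'k"
  assume "f \<in> carrier (group_algebra G)" "h \<in> carrier (group_algebra G)"
  then show "f \<oplus>\<^bsub>group_algebra G\<^esub> h \<in> carrier (group_algebra G)"
    using ga_supp_add[of f h]
    by (auto simp: group_algebra_carrier group_algebra_add intro: finite_subset)
qed (auto simp: group_algebra_carrier group_algebra_add group_algebra_zero ga_supp_def algebra_simps)

lemma ring_group_algebra:
  fixes G :: "('a, 'm) monoid_scheme"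
  assumes "monoid G"
  shows "ring (group_algebra G :: ('a \<Rightarrow> 'k::field) ring)"
proof -
  interpret monoid G by fact
  have closed: "f \<otimes>\<^bsub>group_algebra G\<^esub> h \<in> carrier (group_algebra G)"
    if "f \<in> carrier (group_algebra G)" "h \<in> carrier (group_algebra G)" for f h :: "'a \<Rightarrow> 'k"
    using that group_algebra_mult_supp[of f h G] group_algebra_mult_finite[of f h G]
    by (fastforce simp: group_algebra_carrier)
  show ?thesis
  proof (rule ringI[OF abelian_group_group_algebra])
    show "monoid (group_algebra G :: ('a \<Rightarrow> 'k) ring)"
    proof (rule monoidI)
      fix f h k :: "'a \<Rightarrow> 'k"
      assume fhk: "f \<in> carrier (group_algebra G)" "h \<in> carrier (group_algebra G)"
        "k \<in> carrier (group_algebra G)"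
      then show "f \<otimes>\<^bsub>group_algebra G\<^esub> h \<otimes>\<^bsub>group_algebra G\<^esub> k =
          f \<otimes>\<^bsub>group_algebra G\<^esub> (h \<otimes>\<^bsub>group_algebra G\<^esub> k)"
        \<comment> \<open>Both sides become the same nested pairing, with \<phi> taken at
          \<open>(a b) c\<close> and at \<open>a (b c)\<close>. Associativity holds only on the
          carrier, so the values are compared on supports by \<open>ga_pair_cong\<close>.\<close>
        by (intro ga_eqI) (auto simp: group_algebra_carrier ga_pair_mult ga_finite m_assoc subset_iff
            intro!: ga_pair_cong)
    next
      fix f :: "'a \<Rightarrow> 'k" assume "f \<in> carrier (group_algebra G)"
      then show "\<one>\<^bsub>group_algebra G\<^esub> \<otimes>\<^bsub>group_algebra G\<^esub> f = f"
        and "f \<otimes>\<^bsub>group_algebra G\<^esub> \<one>\<^bsub>group_algebra G\<^esub> = f"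
        by (auto simp: group_algebra_one group_algebra_carrier ga_pair_mult ga_finite subset_iff
            intro!: ga_eqI ga_pair_cong)
    qed (auto simp: closed group_algebra_one)
  next
    fix f h k :: "'a \<Rightarrow> 'k"
    assume "f \<in> carrier (group_algebra G)" "h \<in> carrier (group_algebra G)"
      "k \<in> carrier (group_algebra G)"
    then show "(f \<oplus>\<^bsub>group_algebra G\<^esub> h) \<otimes>\<^bsub>group_algebra G\<^esub> k =
        f \<otimes>\<^bsub>group_algebra G\<^esub> k \<oplus>\<^bsub>group_algebra G\<^esub> h \<otimes>\<^bsub>group_algebra G\<^esub> k"
      and "k \<otimes>\<^bsub>group_algebra G\<^esub> (f \<oplus>\<^bsub>group_algebra G\<^esub> h) =
        k \<otimes>\<^bsub>group_algebra G\<^esub> f \<oplus>\<^bsub>group_algebra G\<^esub> k \<otimes>\<^bsub>group_algebra G\<^esub> h"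
      by (auto simp: group_algebra_carrier ga_pair_mult ga_pair_add ga_finite ga_pair_add_right
          intro!: ga_eqI)
  qed
qed

lemma ga_single_mult:
  "ga_single x c \<otimes>\<^bsub>group_algebra G\<^esub> ga_single y d = ga_single (x \<otimes>\<^bsub>G\<^esub> y) (c * d)"
  by (intro ga_eqI) (auto simp: ga_pair_mult ga_finite)

section \<open>Functoriality of group algebras\<close>

lemma ga_supp_map: "ga_supp (ga_map \<phi> f) \<subseteq> \<phi> ` ga_supp f"
proof
  fix y assume "y \<in> ga_supp (ga_map \<phi> f)"
  then have "ga_map \<phi> f y \<noteq> 0"
    by (simp add: ga_supp_def)
  then obtain x where "x \<in> {x \<in> ga_supp f. \<phi> x = y}"
    unfolding ga_map_def by (rule sum.not_neutral_contains_not_neutral)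
  then show "y \<in> \<phi> ` ga_supp f" by auto
qed

lemma ga_map_finite: "finite (ga_supp f) \<Longrightarrow> finite (ga_supp (ga_map \<phi> f))"
  by (intro finite_subset[OF ga_supp_map]) auto

text \<open>Pushing forward is adjoint to composing the test function with \<phi>: the sum over the
  support is grouped by the fibres of \<phi>. This reduces the homomorphism laws of
  \<open>ga_map\<close> to those of \<phi>.\<close>

lemma ga_pair_map:
  assumes "finite (ga_supp f)"
  shows "ga_pair (ga_map \<phi> f) \<psi> = ga_pair f (\<psi> \<circ> \<phi>)"
proof -
  have "ga_pair (ga_map \<phi> f) \<psi> = (\<Sum>y\<in>\<phi> ` ga_supp f. ga_map \<phi> f y * \<psi> y)"
    using assms ga_supp_map[of \<phi> f] by (intro ga_pair_superset) simp_all
  also have "\<dots> = (\<Sum>y\<in>\<phi> ` ga_supp f. \<Sum>x\<in>{x \<in> ga_supp f. \<phi> x = y}. f x * \<psi> (\<phi> x))"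
    by (simp add: ga_map_def sum_distrib_right)
  also have "\<dots> = (\<Sum>x\<in>ga_supp f. f x * \<psi> (\<phi> x))"
    using assms by (intro sum.group) auto
  finally show ?thesis by (simp add: ga_pair_def)
qed

lemma ga_map_single [simp]: "ga_map \<phi> (ga_single x c) = ga_single (\<phi> x) c"
  by (intro ga_eqI) (auto simp: ga_pair_map ga_map_finite)

lemma ga_map_ring_hom:
  fixes G :: "('a, 'm) monoid_scheme" and H :: "('b, 'n) monoid_scheme"
  assumes "group G" "group H" "\<phi> \<in> hom G H"
  shows "ga_map \<phi> \<in> ring_hom (group_algebra G :: ('a \<Rightarrow> 'k::field) ring) (group_algebra H)"
proof (rule ring_hom_memI)
  fix f :: "'a \<Rightarrow> 'k" assume "f \<in> carrier (group_algebra G)"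
  then show "ga_map \<phi> f \<in> carrier (group_algebra H)"
    using ga_supp_map[of \<phi> f] hom_in_carrier[OF assms(3)]
    by (auto simp: group_algebra_carrier ga_map_finite subset_iff image_iff)
next
  fix f h :: "'a \<Rightarrow> 'k"
  assume "f \<in> carrier (group_algebra G)" "h \<in> carrier (group_algebra G)"
  then show "ga_map \<phi> (f \<otimes>\<^bsub>group_algebra G\<^esub> h) = ga_map \<phi> f \<otimes>\<^bsub>group_algebra H\<^esub> ga_map \<phi> h"
    and "ga_map \<phi> (f \<oplus>\<^bsub>group_algebra G\<^esub> h) = ga_map \<phi> f \<oplus>\<^bsub>group_algebra H\<^esub> ga_map \<phi> h"
    by (auto simp: group_algebra_carrier ga_pair_mult ga_pair_add ga_finite ga_map_finite
        ga_pair_map hom_mult[OF assms(3)] subset_iff intro!: ga_eqI ga_pair_cong)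
next
  \<comment> \<open>\<open>hom\<close> asks only for multiplicativity; that \<phi> fixes the unit
    comes from both sides being groups.\<close>
  show "ga_map \<phi> \<one>\<^bsub>group_algebra G\<^esub> = \<one>\<^bsub>group_algebra H\<^esub>"
    by (simp add: group_algebra_one hom_one[OF assms(3,1,2)])
qed


section \<open>Braid groups\<close>

lemma group_braid_group: "group (braid_group n)"
  unfolding braid_group_def by (rule group_presented_group)

lemma Rho_in_braid_gens [simp]: "Rho \<in> braid_gens n"
  by (simp add: braid_gens_def)

lemma Sigma_in_braid_gens [simp]: "Sigma i \<in> braid_gens n \<longleftrightarrow> i \<in> {1..<n}"
  by (auto simp: braid_gens_def)

lemma braid_gens_Suc: "braid_gens n \<subseteq> braid_gens (Suc n)"
  by (auto simp: braid_gens_def)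

lemma braid_relations_Suc: "braid_relations n \<subseteq> braid_relations (Suc n)"
  unfolding braid_relations_def by (intro Un_mono) (auto; force)+

lemma braid_rel_Suc: "braid_rel n \<subseteq> braid_rel (Suc n)"
  by (intro pres_rel_mono braid_gens_Suc braid_relations_Suc)

lemma words_braid_gens_Suc: "w \<in> words (braid_gens n) \<Longrightarrow> w \<in> words (braid_gens (Suc n))"
  using words_mono[OF braid_gens_Suc] by blast

text \<open>The image of a class is a union of classes of the larger relation. All of them coincide,
  because words related on \<open>n\<close> strands stay related on \<open>Suc n\<close>
  strands.\<close>

lemma braid_incl_class:
  assumes "w \<in> words (braid_gens n)"
  shows "braid_incl n (braid_rel n `` {w}) = braid_rel (Suc n) `` {w}"
proof -
  have self: "w \<in> braid_rel n `` {w}"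
    using assms by (auto intro: pres_rel.refl)
  have same: "braid_rel (Suc n) `` {v} = braid_rel (Suc n) `` {w}" if "v \<in> braid_rel n `` {w}" for v
    using that braid_rel_Suc[of n] by (intro equiv_class_eq[OF equiv_pres_rel, symmetric]) auto
  show ?thesis
    unfolding braid_incl_def
    by (subst Image_eq_UN) (intro UN_constant_eq[OF self] ballI same)
qed

lemma braid_incl_hom: "braid_incl n \<in> hom (braid_group n) (braid_group (Suc n))"
  unfolding braid_group_def
  by (intro homI; elim presented_group_class)
    (simp_all add: braid_incl_class mult_presented_group words_braid_gens_Suc class_in_presented_group)

lemma rho_in_braid_group: "\<rho>\<^sub>1 n \<in> carrier (braid_group n)"
  by (simp add: \<rho>\<^sub>1_def braid_group_def class_in_presented_group)

lemma sigma_in_braid_group: "i \<in> {1..<n} \<Longrightarrow> \<sigma> n i \<in> carrier (braid_group n)"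
  by (simp add: \<sigma>_def braid_group_def class_in_presented_group)

lemma braid_incl_rho: "braid_incl n (\<rho>\<^sub>1 n) = \<rho>\<^sub>1 (Suc n)"
  by (simp add: \<rho>\<^sub>1_def braid_incl_class)

lemma braid_incl_sigma: "i \<in> {1..<n} \<Longrightarrow> braid_incl n (\<sigma> n i) = \<sigma> (Suc n) i"
  by (simp add: \<sigma>_def braid_incl_class)

section \<open>The exponent sum of a braid\<close>

abbreviation word_exp :: "braid_gen word \<Rightarrow> int" where
  "word_exp w \<equiv> sum_list (map letter_exp w)"

lemma letter_exp_cancel: "letter_exp (x, e) + letter_exp (x, \<not> e) = 0"
  by (cases x) auto

lemma word_exp_relation: "(l, r) \<in> braid_relations n \<Longrightarrow> word_exp l = word_exp r"
  by (auto simp: braid_relations_def split: if_splits)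

lemma word_exp_braid_rel:
  assumes "(v, w) \<in> braid_rel n"
  shows "word_exp v = word_exp w"
  using assms
proof induction
  case (cancel x p q e)
  then show ?case using letter_exp_cancel[of x e] by simp
qed (auto dest: word_exp_relation)

text \<open>The word chosen by \<open>SOME\<close> is unknown, but it is related to
  \<open>w\<close>, and the exponent sum is constant on the class.\<close>

lemma exp_sum_class:
  assumes "w \<in> words (braid_gens n)"
  shows "exp_sum (braid_rel n `` {w}) = word_exp w"
proof -
  have "w \<in> braid_rel n `` {w}"
    using assms by (auto intro: pres_rel.refl)
  then have "(SOME v. v \<in> braid_rel n `` {w}) \<in> braid_rel n `` {w}"
    by (rule someI)
  then show ?thesis
    unfolding exp_sum_def using word_exp_braid_rel by fastforce
qed

lemma exp_sum_mult:
  assumes "\<alpha> \<in> carrier (braid_group n)" "\<beta> \<in> carrier (braid_group n)"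
  shows "exp_sum (\<alpha> \<otimes>\<^bsub>braid_group n\<^esub> \<beta>) = exp_sum \<alpha> + exp_sum \<beta>"
  using assms unfolding braid_group_def
  by (elim presented_group_class) (simp add: mult_presented_group exp_sum_class)

text \<open>Follows from additivity applied to the product of the inverse with \<alpha>, without
  looking at inverse words.\<close>

lemma exp_sum_inv:
  assumes "\<alpha> \<in> carrier (braid_group n)"
  shows "exp_sum (inv\<^bsub>braid_group n\<^esub> \<alpha>) = - exp_sum \<alpha>"
proof -
  interpret group "braid_group n" by (rule group_braid_group)
  have "exp_sum \<one>\<^bsub>braid_group n\<^esub> = 0"
    by (simp add: braid_group_def one_presented_group exp_sum_class)
  moreover have "exp_sum (inv\<^bsub>braid_group n\<^esub> \<alpha> \<otimes>\<^bsub>braid_group n\<^esub> \<alpha>) =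
      exp_sum (inv\<^bsub>braid_group n\<^esub> \<alpha>) + exp_sum \<alpha>"
    using assms by (intro exp_sum_mult) auto
  ultimately show ?thesis
    using assms by simp
qed

lemma exp_sum_incl:
  assumes "\<alpha> \<in> carrier (braid_group n)"
  shows "exp_sum (braid_incl n \<alpha>) = exp_sum \<alpha>"
  using assms unfolding braid_group_def
  by (elim presented_group_class) (simp add: braid_incl_class exp_sum_class words_braid_gens_Suc)

lemma exp_sum_sigma: "i \<in> {1..<n} \<Longrightarrow> exp_sum (\<sigma> n i) = 1"
  by (simp add: \<sigma>_def exp_sum_class)

section \<open>Hecke algebras\<close>

lemma ring_KW: "ring (KW n)"
  using ring_group_algebra[OF group.axioms(1)[OF group_braid_group]] .

lemma KW_scal_carrier: "KW_scal n c \<in> carrier (KW n)"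
  unfolding KW_scal_def
  by (intro ga_single_carrier monoid.one_closed group.axioms(1)[OF group_braid_group])

lemma quadratic_carrier:
  assumes "x \<in> carrier (braid_group n)"
  shows "quadratic n q x \<in> carrier (KW n)"
proof -
  interpret ring "KW n" by (rule ring_KW)
  show ?thesis
    using assms by (simp add: quadratic_def Let_def KW_scal_carrier)
qed

lemma hecke_generators_carrier:
  "{quadratic n uu (\<sigma> n i) | i. i \<in> {1..<n}} \<union> {quadratic n vv (\<rho>\<^sub>1 n)} \<subseteq> carrier (KW n)"
  using sigma_in_braid_group rho_in_braid_group by (auto intro!: quadratic_carrier)

lemma ideal_hecke_ideal: "ideal (hecke_ideal n) (KW n)"
  unfolding hecke_ideal_def by (intro ring.genideal_ideal[OF ring_KW] hecke_generators_carrier)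

lemma quadratic_in_hecke_ideal:
  "i \<in> {1..<n} \<Longrightarrow> quadratic n uu (\<sigma> n i) \<in> hecke_ideal n"
  "quadratic n vv (\<rho>\<^sub>1 n) \<in> hecke_ideal n"
  using ring.genideal_self[OF ring_KW hecke_generators_carrier, of n] unfolding hecke_ideal_def
  by auto

lemma ring_Hecke: "ring (Hecke n)"
  unfolding Hecke_def by (rule ideal.quotient_is_ring[OF ideal_hecke_ideal])

lemma hecke_proj_ring_hom: "hecke_proj n \<in> ring_hom (KW n) (Hecke n)"
  using ideal.rcos_ring_hom[OF ideal_hecke_ideal] unfolding Hecke_def hecke_proj_def .

text \<open>Translates equations in the Hecke algebra into membership in the ideal, both to obtain
  the quadratic relation and to prove independence of representatives.\<close>

lemma hecke_proj_eq_iff: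
  assumes "f \<in> carrier (KW n)" "h \<in> carrier (KW n)"
  shows "hecke_proj n f = hecke_proj n h \<longleftrightarrow> f \<ominus>\<^bsub>KW n\<^esub> h \<in> hecke_ideal n"
  unfolding hecke_proj_def
  using ring.quotient_eq_iff_same_a_r_cos[OF ring_KW ideal_hecke_ideal assms] by simp

lemma hecke_of_carrier: "\<alpha> \<in> carrier (braid_group n) \<Longrightarrow> hecke_of n \<alpha> \<in> carrier (Hecke n)"
  unfolding hecke_of_def by (intro ring_hom_closed[OF hecke_proj_ring_hom] ga_single_carrier)

lemma hecke_scal_carrier: "hecke_scal n c \<in> carrier (Hecke n)"
  unfolding hecke_scal_def by (intro ring_hom_closed[OF hecke_proj_ring_hom] KW_scal_carrier)

lemma hecke_of_mult:
  assumes "\<alpha> \<in> carrier (braid_group n)" "\<beta> \<in> carrier (braid_group n)"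
  shows "hecke_of n (\<alpha> \<otimes>\<^bsub>braid_group n\<^esub> \<beta>) = hecke_of n \<alpha> \<otimes>\<^bsub>Hecke n\<^esub> hecke_of n \<beta>"
  using ring_hom_mult[OF hecke_proj_ring_hom, of "ga_single \<alpha> 1" n "ga_single \<beta> 1"] assms
  by (simp add: hecke_of_def ga_single_mult)

lemma hecke_of_one: "hecke_of n \<one>\<^bsub>braid_group n\<^esub> = \<one>\<^bsub>Hecke n\<^esub>"
  using ring_hom_one[OF hecke_proj_ring_hom, of n] by (simp add: hecke_of_def group_algebra_one)

lemma hecke_g_square:
  assumes "i \<in> {1..<n}"
  shows "hecke_g n i \<otimes>\<^bsub>Hecke n\<^esub> hecke_g n i =
    \<one>\<^bsub>Hecke n\<^esub> \<oplus>\<^bsub>Hecke n\<^esub> hecke_scal n (uu - inverse uu) \<otimes>\<^bsub>Hecke n\<^esub> hecke_g n i"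
proof -
  interpret K: ring "KW n" by (rule ring_KW)
  let ?X = "ga_single (\<sigma> n i) 1" and ?q = "KW_scal n (uu - inverse uu)"
  have X: "?X \<in> carrier (KW n)"
    using sigma_in_braid_group[OF assms] by simp
  have q: "?q \<in> carrier (KW n)"
    by (rule KW_scal_carrier)
  have "hecke_proj n (?X \<otimes>\<^bsub>KW n\<^esub> ?X) = hecke_proj n (\<one>\<^bsub>KW n\<^esub> \<oplus>\<^bsub>KW n\<^esub> ?q \<otimes>\<^bsub>KW n\<^esub> ?X)"
    using X q quadratic_in_hecke_ideal(1)[OF assms]
    by (subst hecke_proj_eq_iff) (simp_all add: quadratic_def Let_def)
  then show ?thesis
    using X q
    by (simp add: hecke_of_def hecke_scal_def ring_hom_mult[OF hecke_proj_ring_hom]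
        ring_hom_add[OF hecke_proj_ring_hom] ring_hom_one[OF hecke_proj_ring_hom])
qed

text \<open>With \<open>x\<close> the image of the inverse braid, \<open>g x = 1\<close> holds
  already by multiplicativity. Multiplying \<open>g g = 1 + q g\<close> by \<open>x\<close> on the
  right gives the claim. It is solved for \<open>g\<close> so that it can be substituted into a
  product without subtracting.\<close>

lemma hecke_inv_sigma:
  assumes "i \<in> {1..<n}"
  shows "hecke_g n i = hecke_of n (inv\<^bsub>braid_group n\<^esub> \<sigma> n i) \<oplus>\<^bsub>Hecke n\<^esub> hecke_scal n (uu - inverse uu)"
proof -
  interpret B: group "braid_group n" by (rule group_braid_group)
  interpret H: ring "Hecke n" by (rule ring_Hecke)
  let ?s = "\<sigma> n i" and ?x = "hecke_of n (inv\<^bsub>braid_group n\<^esub> \<sigma> n i)" and ?g = "hecke_g n i"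
  let ?q = "hecke_scal n (uu - inverse uu)"
  have s: "?s \<in> carrier (braid_group n)"
    by (rule sigma_in_braid_group[OF assms])
  have c: "?g \<in> carrier (Hecke n)" "?x \<in> carrier (Hecke n)" "?q \<in> carrier (Hecke n)"
    using s by (simp_all add: hecke_of_carrier hecke_scal_carrier)
  have gx: "?g \<otimes>\<^bsub>Hecke n\<^esub> ?x = \<one>\<^bsub>Hecke n\<^esub>"
    using s by (simp add: hecke_of_mult[symmetric] hecke_of_one)
  have "?g = ?g \<otimes>\<^bsub>Hecke n\<^esub> ?g \<otimes>\<^bsub>Hecke n\<^esub> ?x"
    using c gx by (simp add: H.m_assoc)
  also have "\<dots> = (\<one>\<^bsub>Hecke n\<^esub> \<oplus>\<^bsub>Hecke n\<^esub> ?q \<otimes>\<^bsub>Hecke n\<^esub> ?g) \<otimes>\<^bsub>Hecke n\<^esub> ?x"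
    by (simp only: hecke_g_square[OF assms])
  also have "\<dots> = ?x \<oplus>\<^bsub>Hecke n\<^esub> ?q"
    using c gx by (simp add: H.l_distr H.m_assoc)
  finally show ?thesis .
qed

section \<open>Adding a strand in the Hecke algebras\<close>

lemma KW_map_ring_hom: "ga_map (braid_incl n) \<in> ring_hom (KW n) (KW (Suc n))"
  by (rule ga_map_ring_hom[OF group_braid_group group_braid_group braid_incl_hom])

lemma KW_map_quadratic:
  assumes "x \<in> carrier (braid_group n)"
  shows "ga_map (braid_incl n) (quadratic n q x) = quadratic (Suc n) q (braid_incl n x)"
proof -
  \<comment> \<open>Scalars are supported at the identity braid, which the homomorphism
    preserves.\<close>
  have scal: "ga_map (braid_incl n) (KW_scal n c) = KW_scal (Suc n) c" for c
    by (simp add: KW_scal_def hom_one[OF braid_incl_hom group_braid_group group_braid_group])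
  interpret ring_hom_ring "KW n" "KW (Suc n)" "ga_map (braid_incl n)"
    by (intro ring_hom_ringI2 ring_KW KW_map_ring_hom)
  show ?thesis
    using assms KW_scal_carrier[of n "q - inverse q"]
    by (simp add: quadratic_def Let_def a_minus_def scal)
qed

text \<open>The preimage of the larger ideal is itself an ideal. Since generators map to generators,
  it contains those of \<open>hecke_ideal n\<close>, hence by minimality the whole ideal.\<close>

lemma KW_map_hecke_ideal:
  assumes "f \<in> hecke_ideal n"
  shows "ga_map (braid_incl n) f \<in> hecke_ideal (Suc n)"
proof -
  interpret ring_hom_ring "KW n" "KW (Suc n)" "ga_map (braid_incl n)"
    by (intro ring_hom_ringI2 ring_KW KW_map_ring_hom)
  let ?I = "{f \<in> carrier (KW n). ga_map (braid_incl n) f \<in> hecke_ideal (Suc n)}"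
  have "hecke_ideal n \<subseteq> ?I"
    unfolding hecke_ideal_def[of n]
  proof (rule R.genideal_minimal)
    show "ideal ?I (KW n)"
      by (rule ideal_vimage[OF ideal_hecke_ideal])
    show "{quadratic n uu (\<sigma> n i) | i. i \<in> {1..<n}} \<union> {quadratic n vv (\<rho>\<^sub>1 n)} \<subseteq> ?I"
      using hecke_generators_carrier[of n] quadratic_in_hecke_ideal(1)[of _ "Suc n"] quadratic_in_hecke_ideal(2)[of "Suc n"]
      by (auto simp: KW_map_quadratic sigma_in_braid_group rho_in_braid_group braid_incl_sigma
          braid_incl_rho)
  qed
  with assms show ?thesis by blast
qed

text \<open>Two representatives of a coset differ by an element of the ideal, which is mapped into
  the next ideal; so all sets in the union defining \<open>hecke_incl\<close> are equal.\<close>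

lemma hecke_incl_proj:
  assumes f: "f \<in> carrier (KW n)"
  shows "hecke_incl n (hecke_proj n f) = hecke_proj (Suc n) (ga_map (braid_incl n) f)"
proof -
  interpret ring_hom_ring "KW n" "KW (Suc n)" "ga_map (braid_incl n)"
    by (intro ring_hom_ringI2 ring_KW KW_map_ring_hom)
  interpret I: ideal "hecke_ideal n" "KW n" by (rule ideal_hecke_ideal)
  have self: "f \<in> hecke_proj n f"
    unfolding hecke_proj_def using f by (rule I.a_rcos_self)
  have "hecke_proj (Suc n) (ga_map (braid_incl n) h) = hecke_proj (Suc n) (ga_map (braid_incl n) f)"
    if "h \<in> hecke_proj n f" for h
  proof -
    from that have h: "h \<in> carrier (KW n)"
      unfolding hecke_proj_def using I.a_elemrcos_carrier[OF f] by blast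
    have "hecke_proj n h = hecke_proj n f"
      using I.a_repr_independence'[of h f] that f unfolding hecke_proj_def by simp
    then have "h \<ominus>\<^bsub>KW n\<^esub> f \<in> hecke_ideal n"
      using f h by (simp add: hecke_proj_eq_iff)
    then have "ga_map (braid_incl n) (h \<ominus>\<^bsub>KW n\<^esub> f) \<in> hecke_ideal (Suc n)"
      by (rule KW_map_hecke_ideal)
    then show ?thesis
      using f h by (simp add: hecke_proj_eq_iff a_minus_def)
  qed
  with self show ?thesis
    unfolding hecke_incl_def by (intro UN_constant_eq ballI)
qed

lemma hecke_incl_of:
  assumes "\<alpha> \<in> carrier (braid_group n)"
  shows "hecke_incl n (hecke_of n \<alpha>) = hecke_of (Suc n) (braid_incl n \<alpha>)"
  using assms by (simp add: hecke_of_def hecke_incl_proj)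

section \<open>Invariance under the Markov moves\<close>

lemma uu_nonzero: "uu \<noteq> 0"
  by (simp add: uu_def Zero_fract_def eq_fract)

text \<open>Equality of fractions reduces to equality of polynomials, and \<open>1 + u^2\<close> is
  a nonzero polynomial even though it has complex roots.\<close>

lemma one_plus_uu_square_nonzero: "1 + uu ^ 2 \<noteq> 0"
  by (simp add: uu_def Zero_fract_def One_fract_def eq_fract power2_eq_square one_pCons)

lemma markov_trace_stab_pos:
  assumes "markov_trace z y \<tau>" "n \<ge> 1" "\<alpha> \<in> carrier (braid_group n)"
  shows "\<tau> (Suc n) (hecke_of (Suc n) (braid_incl n \<alpha> \<otimes>\<^bsub>braid_group (Suc n)\<^esub> \<sigma> (Suc n) n)) =
    z * \<tau> n (hecke_of n \<alpha>)"
proof -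
  have "\<tau> (Suc n) (hecke_incl n (hecke_of n \<alpha>) \<otimes>\<^bsub>Hecke (Suc n)\<^esub> hecke_g (Suc n) n) =
      z * \<tau> n (hecke_of n \<alpha>)"
    using assms hecke_of_carrier[OF assms(3)] unfolding markov_trace_def by blast
  then show ?thesis
    using assms
    by (simp add: hecke_incl_of hecke_of_mult sigma_in_braid_group hom_in_carrier[OF braid_incl_hom])
qed

lemma markov_trace_stab_neg:
  assumes "markov_trace z y \<tau>" "n \<ge> 1" "\<alpha> \<in> carrier (braid_group n)"
  shows "\<tau> (Suc n) (hecke_of (Suc n)
      (braid_incl n \<alpha> \<otimes>\<^bsub>braid_group (Suc n)\<^esub> inv\<^bsub>braid_group (Suc n)\<^esub> \<sigma> (Suc n) n)) =
    (z - (uu - inverse uu)) * \<tau> n (hecke_of n \<alpha>)"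
proof -
  interpret B: group "braid_group (Suc n)" by (rule group_braid_group)
  interpret H: ring "Hecke (Suc n)" by (rule ring_Hecke)
  let ?H = "Hecke (Suc n)" and ?B = "braid_group (Suc n)"
  let ?A = "hecke_of (Suc n) (braid_incl n \<alpha>)" and ?q = "hecke_scal (Suc n) (uu - inverse uu)"
  let ?x = "hecke_of (Suc n) (inv\<^bsub>?B\<^esub> \<sigma> (Suc n) n)" and ?g = "hecke_g (Suc n) n"
  have s: "\<sigma> (Suc n) n \<in> carrier ?B" "braid_incl n \<alpha> \<in> carrier ?B"
    using assms by (auto intro: sigma_in_braid_group hom_in_carrier[OF braid_incl_hom])
  have c: "?A \<in> carrier ?H" "?q \<in> carrier ?H" "?x \<in> carrier ?H"
    using s by (simp_all add: hecke_of_carrier hecke_scal_carrier)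
  have tr: "\<tau> (Suc n) (a \<oplus>\<^bsub>?H\<^esub> b) = \<tau> (Suc n) a + \<tau> (Suc n) b"
    "\<tau> (Suc n) (a \<otimes>\<^bsub>?H\<^esub> b) = \<tau> (Suc n) (b \<otimes>\<^bsub>?H\<^esub> a)"
    "\<tau> (Suc n) (hecke_scal (Suc n) k \<otimes>\<^bsub>?H\<^esub> a) = k * \<tau> (Suc n) a"
    if "a \<in> carrier ?H" "b \<in> carrier ?H" for a b k
    using assms(1) that unfolding markov_trace_def by auto
  have "\<tau> (Suc n) (hecke_incl n (hecke_of n \<alpha>)) = \<tau> n (hecke_of n \<alpha>)"
    using assms hecke_of_carrier[OF assms(3)] unfolding markov_trace_def by blast
  then have A: "\<tau> (Suc n) ?A = \<tau> n (hecke_of n \<alpha>)"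
    using assms by (simp add: hecke_incl_of)
  have "z * \<tau> n (hecke_of n \<alpha>) = \<tau> (Suc n) (?A \<otimes>\<^bsub>?H\<^esub> ?g)"
    using markov_trace_stab_pos[OF assms] s by (simp add: hecke_of_mult)
  \<comment> \<open>The generator is replaced by its inverse plus the scalar \<open>?q\<close>,
    which splits the known positive stabilization into the negative one and a multiple of the trace
    of \<alpha>.\<close>
  also have "\<dots> = \<tau> (Suc n) (?A \<otimes>\<^bsub>?H\<^esub> ?x \<oplus>\<^bsub>?H\<^esub> ?A \<otimes>\<^bsub>?H\<^esub> ?q)"
    using c assms(2) by (subst hecke_inv_sigma) (simp_all add: H.r_distr)
  \<comment> \<open>Linearity of the trace is stated for a scalar on the left, while
    \<open>?q\<close> stands on the right of \<open>?A\<close>; the trace property swaps them. The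
    repeated \<open>c(1)\<close> only fills the second premise of \<open>tr\<close>.\<close>
  also have "\<dots> = \<tau> (Suc n) (?A \<otimes>\<^bsub>?H\<^esub> ?x) + (uu - inverse uu) * \<tau> n (hecke_of n \<alpha>)"
    using c by (simp add: tr(1) tr(2)[of ?A ?q] tr(3)[OF c(1) c(1)] A)
  finally show ?thesis
    using s by (simp add: hecke_of_mult algebra_simps)
qed

lemma markov_trace_conjugation:
  assumes "markov_trace z y \<tau>" "n \<ge> 1" "\<alpha> \<in> carrier (braid_group n)" "\<beta> \<in> carrier (braid_group n)"
  shows "\<tau> n (hecke_of n (\<beta> \<otimes>\<^bsub>braid_group n\<^esub> \<alpha> \<otimes>\<^bsub>braid_group n\<^esub> inv\<^bsub>braid_group n\<^esub> \<beta>)) =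
    \<tau> n (hecke_of n \<alpha>)"
proof -
  interpret B: group "braid_group n" by (rule group_braid_group)
  let ?\<gamma> = "\<beta> \<otimes>\<^bsub>braid_group n\<^esub> \<alpha>" and ?\<delta> = "inv\<^bsub>braid_group n\<^esub> \<beta>"
  have c: "?\<gamma> \<in> carrier (braid_group n)" "?\<delta> \<in> carrier (braid_group n)"
    using assms by auto
  have "\<tau> n (hecke_of n ?\<gamma> \<otimes>\<^bsub>Hecke n\<^esub> hecke_of n ?\<delta>) = \<tau> n (hecke_of n ?\<delta> \<otimes>\<^bsub>Hecke n\<^esub> hecke_of n ?\<gamma>)"
    using assms(1,2) c[THEN hecke_of_carrier] unfolding markov_trace_def by blast
  then have "\<tau> n (hecke_of n (?\<gamma> \<otimes>\<^bsub>braid_group n\<^esub> ?\<delta>)) = \<tau> n (hecke_of n (?\<delta> \<otimes>\<^bsub>braid_group n\<^esub> ?\<gamma>))"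
    using c by (simp only: hecke_of_mult)
  also have "?\<delta> \<otimes>\<^bsub>braid_group n\<^esub> ?\<gamma> = \<alpha>"
    using assms by (simp add: B.m_assoc[symmetric])
  finally show ?thesis .
qed

section \<open>The effect of the moves on the normalised trace\<close>

lemma VB_eq_trace:
  assumes "induced_on_TL \<tau> \<tau>'" "n \<ge> 1" "\<alpha> \<in> carrier (braid_group n)"
  shows "VB \<tau>' n \<alpha> =
    (- ((1 + uu ^ 2) / uu)) ^ (n - 1) * uu powi (2 * exp_sum \<alpha>) * \<tau> n (hecke_of n \<alpha>)"
  using assms hecke_of_carrier[OF assms(3)] by (simp add: VB_def pibar_def induced_on_TL_def)

text \<open>The bookkeeping shared by both stabilizations: \<open>c\<close> is the factor for a new
  strand, \<open>u powi d\<close> that for the new crossing, and \<open>w\<close> the scaling of the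
  trace. As \<sigma> \<open>m\<close> adds a strand, the exponent \<open>m - 1\<close> becomes
  \<open>m\<close>; with \<open>m \<ge> 1\<close> this natural subtraction is exact and one
  \<open>c\<close> splits off.\<close>

lemma power_powi_shift:
  fixes c u w :: "'a::field"
  assumes "m \<ge> 1" "u \<noteq> 0" "c * u powi d * w = 1"
  shows "c ^ m * u powi (k + d) * w = c ^ (m - 1) * u powi k"
proof -
  obtain l where "m = Suc l"
    using assms(1) by (cases m) auto
  then have "c ^ m * u powi (k + d) * w = (c * u powi d * w) * (c ^ l * u powi k)"
    using assms(2) by (simp add: power_int_add mult_ac)
  with assms(3) \<open>m = Suc l\<close> show ?thesis
    by simp
qed

lemma markov_move_VB:
  assumes z: "z = - (1 / (uu * (1 + uu ^ 2)))"
    and \<tau>: "markov_trace z y \<tau>" and ind: "induced_on_TL \<tau> \<tau>'"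
    and "markov_move (m, \<alpha>) (n, \<beta>)"
  shows "VB \<tau>' m \<alpha> = VB \<tau>' n \<beta>"
proof -
  \<comment> \<open>Products of the nonzero scalars \<open>u\<close> and \<open>1 + u^2\<close>,
    prepared so that the multiplied-out denominators in \<open>denom\<close> are known to be
    nonzero.\<close>
  have "uu * (1 + uu * uu) \<noteq> 0" "uu * uu * (1 + uu * uu) \<noteq> 0"
    using uu_nonzero one_plus_uu_square_nonzero by (simp_all add: power2_eq_square)
  then have denom: "uu + uu * (uu * uu) \<noteq> 0" "uu * uu + uu * (uu * (uu * uu)) \<noteq> 0"
    by (simp_all add: algebra_simps)
  from assms(4) show ?thesis
  proof cases
    case (conjugation \<gamma>)
    interpret B: group "braid_group m" by (rule group_braid_group)
    \<comment> \<open>The contributions of \<gamma> and its inverse cancel in the integers, and the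
      number of strands is unchanged.\<close>
    have "exp_sum (\<gamma> \<otimes>\<^bsub>braid_group m\<^esub> \<alpha> \<otimes>\<^bsub>braid_group m\<^esub> inv\<^bsub>braid_group m\<^esub> \<gamma>) = exp_sum \<alpha>"
      using conjugation by (simp add: exp_sum_mult exp_sum_inv)
    then show ?thesis
      using conjugation by (simp add: VB_eq_trace[OF ind] markov_trace_conjugation[OF \<tau>])
  next
    case stab_pos
    interpret B: group "braid_group (Suc m)" by (rule group_braid_group)
    have c: "\<sigma> (Suc m) m \<in> carrier (braid_group (Suc m))" "braid_incl m \<alpha> \<in> carrier (braid_group (Suc m))"
      using stab_pos by (auto intro: sigma_in_braid_group hom_in_carrier[OF braid_incl_hom])
    have e: "2 * exp_sum \<beta> = 2 * exp_sum \<alpha> + 2"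
      using stab_pos c by (simp add: exp_sum_mult exp_sum_incl exp_sum_sigma)
    \<comment> \<open>This cancellation is what the value of \<open>z\<close> is made for: the first
      two factors multiply to \<open>- u (1 + u^2)\<close>, whose inverse is
      \<open>z\<close>.\<close>
    have "- ((1 + uu ^ 2) / uu) * uu powi 2 * z = 1"
      using uu_nonzero one_plus_uu_square_nonzero denom by (simp add: z field_simps power2_eq_square)
    then have "(- ((1 + uu ^ 2) / uu)) ^ m * uu powi (2 * exp_sum \<beta>) * z =
        (- ((1 + uu ^ 2) / uu)) ^ (m - 1) * uu powi (2 * exp_sum \<alpha>)"
      unfolding e by (rule power_powi_shift[OF stab_pos(3) uu_nonzero])
    then show ?thesis
      using stab_pos c markov_trace_stab_pos[OF \<tau>, of m \<alpha>]
      by (simp add: VB_eq_trace[OF ind] mult.assoc[symmetric])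
  next
    case stab_neg
    interpret B: group "braid_group (Suc m)" by (rule group_braid_group)
    have c: "\<sigma> (Suc m) m \<in> carrier (braid_group (Suc m))" "braid_incl m \<alpha> \<in> carrier (braid_group (Suc m))"
      using stab_neg by (auto intro: sigma_in_braid_group hom_in_carrier[OF braid_incl_hom])
    have e: "2 * exp_sum \<beta> = 2 * exp_sum \<alpha> + (- 2)"
      using stab_neg c by (simp add: exp_sum_mult exp_sum_incl exp_sum_inv exp_sum_sigma)
    let ?w = "z - (uu - inverse uu)"
    \<comment> \<open>Over the common denominator \<open>u (1 + u^2)\<close> the numerator is
      \<open>- 1 - u^2 - u^4 + 1 + u^2 = - u^4\<close>. The closed form is the inverse of
      \<open>- (1 + u^2) / u^3\<close>, the product of the strand and crossing factors.\<close>
    have "?w = - (uu ^ 3 / (1 + uu ^ 2))"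
      using uu_nonzero one_plus_uu_square_nonzero denom
      by (simp add: z field_simps power2_eq_square power3_eq_cube)
    then have "- ((1 + uu ^ 2) / uu) * uu powi (- 2) * ?w = 1"
      using uu_nonzero one_plus_uu_square_nonzero denom
      by (simp add: power_int_minus field_simps power2_eq_square power3_eq_cube)
    then have "(- ((1 + uu ^ 2) / uu)) ^ m * uu powi (2 * exp_sum \<beta>) * ?w =
        (- ((1 + uu ^ 2) / uu)) ^ (m - 1) * uu powi (2 * exp_sum \<alpha>)"
      unfolding e by (rule power_powi_shift[OF stab_neg(3) uu_nonzero])
    then show ?thesis
      using stab_neg c markov_trace_stab_neg[OF \<tau>, of m \<alpha>]
      by (simp add: VB_eq_trace[OF ind] mult.assoc[symmetric])
  qed
qed

theorem mainTheorem4: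
  fixes z y :: scal
    and \<tau> :: "nat \<Rightarrow> hecke_elt \<Rightarrow> scal"
    and \<tau>' :: "nat \<Rightarrow> TL_elt \<Rightarrow> scal"
    and m n :: nat
    and \<alpha> \<beta> :: braid
  assumes "z = - (1 / (uu * (1 + uu ^ 2)))"
    and "y = (vv ^ 2 - 1) / ((1 + uu ^ 2) * vv)"
    and "markov_trace z y \<tau>"
    and "induced_on_TL \<tau> \<tau>'"
    and "m \<ge> 1" and "\<alpha> \<in> carrier (braid_group m)"
    and "n \<ge> 1" and "\<beta> \<in> carrier (braid_group n)"
    and "equivclp markov_move (m, \<alpha>) (n, \<beta>)"
  shows "VB \<tau>' m \<alpha> = VB \<tau>' n \<beta>"
proof -
  \<comment> \<open>The end point is generalised to an arbitrary pair \<open>p\<close>, since the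
    intermediate braids of a chain of moves may have any number of strands.\<close>
  have "VB \<tau>' m \<alpha> = VB \<tau>' (fst p) (snd p)" if "equivclp markov_move (m, \<alpha>) p" for p
    using that
  proof induction
    \<comment> \<open>Each link of the chain is a move from \<open>p\<close> to \<open>q\<close> or
      from \<open>q\<close> to \<open>p\<close>, so invariance is supplied in both directions.
      Membership in the braid groups comes from the rules of the move itself.\<close>
    case (step p q)
    then show ?case
      using markov_move_VB[OF assms(1,3,4), of "fst p" "snd p" "fst q" "snd q"]
        markov_move_VB[OF assms(1,3,4), of "fst q" "snd q" "fst p" "snd p"]
      by auto
  qed simp
  from this[OF assms(9)] show ?thesis by simp
qed

end
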